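(* Let $0\le a<b$ and let $f:[a,b]\to\mathbb{R}$ be continuous, piecewise strictly monotone and differentiable on $[a,b]$. Let $\Gamma=\{(x,f(x)) : x\in[a,b]\}$ be the curve $y=f(x)$, and put $c=\min(f(a),f(b))$, $d=\max(f(a),f(b))$. Suppose that $c<d$ and that each of the lines $y=c$ and $y=d$ intersects the curve $y=f(x)$, $x\in[a,b]$, in exactly one point. Then the volume $V_Y$ of the solid obtained by rotating about the $y$-axis the plane region bounded by $x=0$, $y=c$, $\Gamma$ and $y=d$ is $$V_Y=\operatorname{sgn}(f(b)-f(a))\left\{\pi\left[b^2f(b)-a^2f(a)\right]-2\pi\int_a^b x f(x)\,dx\right\}.$$
   Context: $\operatorname{sgn}$ denotes the sign function: $\operatorname{sgn}(t)=1$ for $t>0$, $\operatorname{sgn}(0)=0$, $\operatorname{sgn}(t)=-1$ for $t<0$. A function is piecewise strictly monotone on $[a,b]$ if $[a,b]$ can be divided into finitely many closed subintervals, consecutive ones sharing only an endpoint, on each of which the function is strictly monotone. The plane region bounded by $x=0$, $y=c$, $\Gamma$ and $y=d$ is the bounded region enclosed by the closed curve consisting of the segment of the $y$-axis from $(0,c)$ to $(0,d)$, the horizontal segment from $(0,f(a))$ to $(a,f(a))$ (a single point if $a=0$), the curve $\Gamma$, and the horizontal segment from $(0,f(b))$ to $(b,f(b))$. *)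

theory Defs
  imports "HOL-Analysis.Analysis"
begin

definition piecewise_strictly_monotone :: "real \<Rightarrow> real \<Rightarrow> (real \<Rightarrow> real) \<Rightarrow> bool" where
  "piecewise_strictly_monotone a b f \<longleftrightarrow>
     (\<exists>(n::nat) (t::nat \<Rightarrow> real). t 0 = a \<and> t n = b \<and>
        (\<forall>i<n. t i < t (Suc i) \<and>
           (strict_mono_on {t i..t (Suc i)} f \<or> strict_antimono_on {t i..t (Suc i)} f)))"

definition graph_curve :: "real \<Rightarrow> real \<Rightarrow> (real \<Rightarrow> real) \<Rightarrow> (real \<times> real) set" where
  "graph_curve a b f = (\<lambda>x. (x, f x)) ` {a..b}"

definition boundary_curve :: "real \<Rightarrow> real \<Rightarrow> (real \<Rightarrow> real) \<Rightarrow> (real \<times> real) set" where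
  "boundary_curve a b f =
     closed_segment (0, min (f a) (f b)) (0, max (f a) (f b))
     \<union> closed_segment (0, f a) (a, f a)
     \<union> graph_curve a b f
     \<union> closed_segment (0, f b) (b, f b)"

text \<open>The region includes its bounding curve, so that the solid obtained from it is compact.\<close>

definition plane_region :: "real \<Rightarrow> real \<Rightarrow> (real \<Rightarrow> real) \<Rightarrow> (real \<times> real) set" where
  "plane_region a b f = inside (boundary_curve a b f) \<union> boundary_curve a b f"

text \<open>Points of space are triples \<open>(x, y, z)\<close>, and the plane is embedded as \<open>z = 0\<close>.\<close>

definition rotate_about_y_axis :: "(real \<times> real) set \<Rightarrow> (real \<times> real \<times> real) set" where
  "rotate_about_y_axis R = {(x * cos \<theta>, y, x * sin \<theta>) | x y \<theta>. (x, y) \<in> R}"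

end

theory Submission
  imports Defs
begin

text \<open>
  The line \<open>y = f b\<close> meets \<open>\<Gamma>\<close> only over the endpoint \<open>b\<close>, so by the intermediate value theorem
  the rest of \<open>\<Gamma>\<close> lies strictly on one side of it, namely that of \<open>f a\<close>. However \<open>\<Gamma>\<close>
  oscillates there, the region is therefore the part of the plane over \<open>[0, b]\<close> between
  two graphs: that of the constant \<open>f b\<close>, and that of the continuous function \<open>g\<close> which is \<open>f a\<close>
  on \<open>[0, a]\<close> and \<open>f\<close> on \<open>[a, b]\<close>. The graphs meet only over \<open>b\<close>; which one is on top depends on
  the sign of \<open>f b - f a\<close>.

  Integrating along cylindrical shells instead of horizontal slices then avoids inverting \<open>f\<close> on
  its monotone pieces: with \<open>f a < f b\<close> the volume is
  \<open>2\<pi> \<integral> x (f b - g x) dx\<close> over \<open>[0, b]\<close>, and splitting at \<open>a\<close> (lemma \<open>integral_clamped\<close>) gives the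
  stated formula. With \<open>f b < f a\<close> the integrand changes sign, which is the factor \<open>sgn\<close>.

  Two points carry the weight. That the enclosed region is exactly the band between the graphs
  (\<open>inside_band_boundary\<close>) follows, without the Jordan curve theorem, from the fact that a
  connected set leaving the open band crosses its frontier, while every point outside the closed
  band escapes to infinity along a vertical ray. The shell formula (\<open>volume_by_shells\<close>) is
  Fubini's theorem over the disc of radius \<open>b\<close> followed by integration of a radial function
  (\<open>nn_integral_radial_disc\<close>), where the density \<open>2\<pi>r\<close> is read off from the areas of discs.
\<close>

section \<open>The region enclosed between two graphs\<close>

definition band :: "real \<Rightarrow> (real \<Rightarrow> real) \<Rightarrow> (real \<Rightarrow> real) \<Rightarrow> (real \<times> real) set" where
  "band b lo hi = {(x, y). 0 \<le> x \<and> x \<le> b \<and> lo x \<le> y \<and> y \<le> hi x}"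

text \<open>There is no segment on the right: the two graphs are meant to meet over \<open>b\<close>.\<close>

definition band_boundary :: "real \<Rightarrow> (real \<Rightarrow> real) \<Rightarrow> (real \<Rightarrow> real) \<Rightarrow> (real \<times> real) set" where
  "band_boundary b lo hi = {0} \<times> {lo 0..hi 0} \<union> graph_curve 0 b lo \<union> graph_curve 0 b hi"

lemma closed_band:
  assumes "continuous_on UNIV lo" "continuous_on UNIV hi"
  shows "closed (band b lo hi)"
proof -
  have lo: "continuous_on UNIV (\<lambda>p::real \<times> real. lo (fst p))"
    and hi: "continuous_on UNIV (\<lambda>p::real \<times> real. hi (fst p))"
    using assms by (auto intro!: continuous_on_compose2[OF _ continuous_on_fst[OF continuous_on_id]])
  have "band b lo hi = {p. 0 \<le> fst p} \<inter> {p. fst p \<le> b} \<inter> {p. lo (fst p) \<le> snd p}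
      \<inter> {p. snd p \<le> hi (fst p)}"
    by (auto simp: band_def)
  also have "closed \<dots>"
    by (intro closed_Int closed_Collect_le lo hi continuous_intros)
  finally show ?thesis .
qed

lemma bounded_band:
  assumes "continuous_on UNIV lo" "continuous_on UNIV hi"
  shows "bounded (band b lo hi)"
proof -
  have "compact (lo ` {0..b})" "compact (hi ` {0..b})"
    using assms by (auto intro!: compact_continuous_image intro: continuous_on_subset)
  then have "bounded (lo ` {0..b} \<union> hi ` {0..b})"
    using compact_imp_bounded by auto
  then obtain B where B: "\<And>x. x \<in> {0..b} \<Longrightarrow> \<bar>lo x\<bar> \<le> B \<and> \<bar>hi x\<bar> \<le> B"
    unfolding bounded_iff by force
  have "band b lo hi \<subseteq> {0..b} \<times> {-B..B}"
    using B by (fastforce simp: band_def)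
  then show ?thesis
    by (rule bounded_subset[rotated]) (auto intro: bounded_Times)
qed

text \<open>A ray is connected and unbounded, so it makes the component of its starting point
  unbounded.\<close>

lemma not_inside_if_vertical_ray:
  fixes S :: "(real \<times> real) set"
  assumes "s = 1 \<or> s = (-1::real)" and ray: "\<And>t. 0 \<le> t \<Longrightarrow> (x, y + s * t) \<notin> S"
  shows "(x, y) \<notin> inside S"
proof
  assume "(x, y) \<in> inside S"
  then have bd: "bounded (connected_component_set (- S) (x, y))"
    by (simp add: inside_def)
  define R where "R = (\<lambda>t. (x, y + s * t)) ` {0..}"
  have "connected R"
    unfolding R_def by (intro connected_continuous_image continuous_intros) simp
  moreover have "(x, y) \<in> R"
    unfolding R_def by (rule image_eqI[of _ _ 0]) auto
  moreover have "R \<subseteq> - S"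
    using ray by (auto simp: R_def)
  ultimately have "R \<subseteq> connected_component_set (- S) (x, y)"
    by (intro connected_component_maximal)
  with bd have "bounded R"
    by (rule bounded_subset)
  then obtain B where B: "\<And>p. p \<in> R \<Longrightarrow> norm p \<le> B"
    unfolding bounded_iff by blast
  \<comment> \<open>Far enough along the ray to beat the offset \<open>y\<close> as well as the supposed bound.\<close>
  define t where "t = \<bar>B\<bar> + \<bar>y\<bar> + 1"
  have "norm (x, y + s * t) \<le> B"
    by (rule B) (auto simp: R_def t_def)
  moreover have "\<bar>y + s * t\<bar> \<le> norm (x, y + s * t)"
    using norm_snd_le[of "y + s * t" x] by simp
  ultimately show False
    using assms(1) by (auto simp: t_def)
qed

text \<open>
  The frontier of the open band \<open>U\<close> lies in the boundary curve, so a component of the complement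
  that meets \<open>U\<close> stays in \<open>U\<close> and is bounded. A point off the closed band is either strictly below
  the lower graph, and sees nothing of the curve when looking down, or sees nothing of it when
  looking up.
\<close>

lemma inside_band_boundary:
  assumes cont: "continuous_on UNIV lo" "continuous_on UNIV hi"
    and b: "0 < b" and less: "\<And>x. 0 \<le> x \<Longrightarrow> x < b \<Longrightarrow> lo x < hi x" and eq: "lo b = hi b"
  shows "inside (band_boundary b lo hi) \<union> band_boundary b lo hi = band b lo hi"
proof -
  let ?S = "band_boundary b lo hi"
  define U where "U = {(x, y). 0 < x \<and> x < b \<and> lo x < y \<and> y < hi x}"
  have le: "lo x \<le> hi x" if "0 \<le> x" "x \<le> b" for x
    using less[of x] eq that by (cases "x = b") auto
  have S_sub: "?S \<subseteq> band b lo hi"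
    using b by (auto simp: band_boundary_def graph_curve_def band_def le)
  have split: "band b lo hi \<subseteq> U \<union> ?S"
  proof
    fix p assume "p \<in> band b lo hi"
    then obtain x y where p: "p = (x, y)" "0 \<le> x" "x \<le> b" "lo x \<le> y" "y \<le> hi x"
      by (auto simp: band_def)
    then consider "x = 0" | "y = lo x" | "y = hi x" | "x = b" | "(x, y) \<in> U"
      unfolding U_def by force
    then show "p \<in> U \<union> ?S"
      by cases (use p eq in \<open>auto simp: band_boundary_def graph_curve_def\<close>)
  qed
  have disj: "U \<inter> ?S = {}"
    by (auto simp: U_def band_boundary_def graph_curve_def)
  have U_sub: "U \<subseteq> band b lo hi"
    by (auto simp: U_def band_def)
  have "open U"
  proof -
    have lo: "continuous_on UNIV (\<lambda>p::real \<times> real. lo (fst p))"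
      and hi: "continuous_on UNIV (\<lambda>p::real \<times> real. hi (fst p))"
      using cont by (auto intro!: continuous_on_compose2[OF _ continuous_on_fst[OF continuous_on_id]])
    have "U = {p. 0 < fst p} \<inter> {p. fst p < b} \<inter> {p. lo (fst p) < snd p}
        \<inter> {p. snd p < hi (fst p)}"
      by (auto simp: U_def)
    also have "open \<dots>"
      by (intro open_Int open_Collect_less lo hi continuous_intros)
    finally show ?thesis .
  qed
  have "closure U \<subseteq> band b lo hi"
    by (rule closure_minimal[OF U_sub closed_band[OF cont]])
  then have frontier: "frontier U \<subseteq> ?S"
    using split interior_open[OF \<open>open U\<close>] by (auto simp: frontier_def)
  have "U \<subseteq> inside ?S"
  proof
    fix p assume p: "p \<in> U"
    let ?C = "connected_component_set (- ?S) p"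
    have "p \<in> ?C"
      using p disj by (auto intro: connected_component_refl)
    moreover have "?C \<inter> frontier U = {}"
      using frontier connected_component_subset[of "- ?S" p] by blast
    ultimately have "?C \<subseteq> U"
      using connected_Int_frontier[of ?C U] p connected_connected_component by blast
    then have "bounded ?C"
      using U_sub bounded_band[OF cont] bounded_subset by blast
    then show "p \<in> inside ?S"
      using p disj by (auto simp: inside_def)
  qed
  moreover have "(x, y) \<notin> inside ?S" if out: "(x, y) \<notin> band b lo hi" for x y
  proof (cases "0 \<le> x \<and> x \<le> b \<and> y < lo x")
    case True
    then show ?thesis
      using S_sub by (intro not_inside_if_vertical_ray[of "-1"]) (auto simp: band_def)
  next
    case False
    then have "(x, y + t) \<notin> band b lo hi" if "0 \<le> t" for t
      using out that by (auto simp: band_def)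
    then show ?thesis
      using S_sub by (intro not_inside_if_vertical_ray[of 1]) auto
  qed
  ultimately show ?thesis
    using S_sub split U_sub by auto
qed

section \<open>Radial functions on a disc\<close>

lemma nn_integral_2pi_r_Ioc:
  assumes "s \<le> b" "0 \<le> s"
  shows "(\<integral>\<^sup>+ r. ennreal (2 * pi * r) * indicator {s<..b} r \<partial>lborel) = ennreal (pi * (b\<^sup>2 - s\<^sup>2))"
proof -
  have "((\<lambda>r. 2 * pi * r) has_integral (pi * b\<^sup>2 - pi * s\<^sup>2)) {s..b}"
    using assms
    by (intro fundamental_theorem_of_calculus)
       (auto intro!: derivative_eq_intros simp flip: has_real_derivative_iff_has_vector_derivative)
  then have *: "((\<lambda>r. 2 * pi * r) has_integral (pi * b\<^sup>2 - pi * s\<^sup>2)) {s<..b}"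
    by (rule has_integral_spike_set_eq[THEN iffD1, rotated 2])
       (auto intro: negligible_subset[of "{s}"])
  have "(\<integral>\<^sup>+ r. ennreal (indicator {s<..b} r * (2 * pi * r)) \<partial>lborel) = ennreal (pi * b\<^sup>2 - pi * s\<^sup>2)"
    using assms by (intro nn_integral_has_integral_lebesgue[OF _ *]) auto
  then show ?thesis
    by (simp add: right_diff_distrib indicator_mult_ennreal mult.commute)
qed

text \<open>
  Polar coordinates for radial integrands. The image \<open>M\<close> of the area measure on the disc under the
  norm gives \<open>{s<..}\<close>, for \<open>0 \<le> s \<le> b\<close>, the area \<open>\<pi> (b\<^sup>2 - s\<^sup>2)\<close> of an annulus, and so does the measure \<open>N\<close> with
  density \<open>2\<pi>r\<close>; finite measures on the line that agree on these rays are equal.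
\<close>

lemma nn_integral_radial_disc:
  fixes h :: "real \<Rightarrow> ennreal"
  assumes "0 \<le> b" and [measurable]: "h \<in> borel_measurable borel"
  shows "(\<integral>\<^sup>+ p. indicator (cball 0 b) p * h (norm p) \<partial>(lborel :: (real \<times> real) measure))
       = (\<integral>\<^sup>+ r. ennreal (2 * pi * r) * indicator {0..b} r * h r \<partial>lborel)"
proof -
  define D where "D = density (lborel :: (real \<times> real) measure) (indicator (cball 0 b))"
  define M where "M = distr D borel norm"
  define N where "N = density lborel (\<lambda>r. ennreal (2 * pi * r) * indicator {0..b} r)"
  have [measurable]: "norm \<in> measurable D borel"
    by (simp add: D_def)
  have area: "emeasure lborel (cball (0 :: real \<times> real) s) = ennreal (pi * s\<^sup>2)" if "0 \<le> s" for s
    using that by (simp add: emeasure_cball power2_eq_square unit_ball_vol_2)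
  have M: "emeasure M {s<..} = ennreal (if s < 0 then pi * b\<^sup>2 else if s \<le> b then pi * (b\<^sup>2 - s\<^sup>2) else 0)" for s
  proof -
    have "emeasure M {s<..} = emeasure D (norm -` {s<..})"
      by (simp add: M_def emeasure_distr) (simp add: D_def)
    also have "\<dots> = emeasure lborel (cball 0 b \<inter> norm -` {s<..} :: (real \<times> real) set)"
    proof -
      have "norm -` {s<..} = {x :: real \<times> real. s < norm x}" by auto
      then have [measurable]: "norm -` {s<..} \<in> sets (borel :: (real \<times> real) measure)"
        by simp
      show ?thesis
        unfolding D_def by (subst emeasure_density) (simp_all add: borel_measurable_indicator flip: indicator_inter_arith)
    qed
    also have "cball 0 b \<inter> norm -` {s<..} = (cball 0 b - cball 0 s :: (real \<times> real) set)"
      by auto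
    also have "emeasure lborel \<dots> =
        ennreal (if s < 0 then pi * b\<^sup>2 else if s \<le> b then pi * (b\<^sup>2 - s\<^sup>2) else 0)"
    proof -
      consider "s < 0" | "0 \<le> s" "s \<le> b" | "0 \<le> s" "b < s" by linarith
      then show ?thesis
      proof cases
        case 1
        then show ?thesis using assms(1) by (simp add: area)
      next
        case 2
        then have "emeasure lborel (cball 0 b - cball 0 s :: (real \<times> real) set)
            = emeasure lborel (cball (0 :: real \<times> real) b) - emeasure lborel (cball (0 :: real \<times> real) s)"
          by (intro emeasure_Diff) (auto simp: area)
        with 2 assms(1) show ?thesis
          by (simp add: area ennreal_minus right_diff_distrib)
      next
        case 3
        then have "cball 0 b - cball 0 s = ({} :: (real \<times> real) set)" by auto
        with 3 show ?thesis by (simp only:) simp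
      qed
    qed
    finally show ?thesis .
  qed
  have N: "emeasure N {s<..} = ennreal (if s < 0 then pi * b\<^sup>2 else if s \<le> b then pi * (b\<^sup>2 - s\<^sup>2) else 0)" for s
  proof -
    have "emeasure N {s<..} = (\<integral>\<^sup>+ r. ennreal (2 * pi * r) * indicator {0..b} r * indicator {s<..} r \<partial>lborel)"
      unfolding N_def by (subst emeasure_density) auto
    \<comment> \<open>For negative \<open>s\<close> the two ranges differ only in the point 0, where \<open>2\<pi>r\<close> vanishes.\<close>
    also have "\<dots> = (\<integral>\<^sup>+ r. ennreal (2 * pi * r) * indicator {max 0 s<..b} r \<partial>lborel)"
      by (intro nn_integral_cong) (auto simp: indicator_def not_less le_less)
    also have "\<dots> = ennreal (if s < 0 then pi * b\<^sup>2 else if s \<le> b then pi * (b\<^sup>2 - s\<^sup>2) else 0)"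
      using nn_integral_2pi_r_Ioc[of "max 0 s" b] assms(1) by (cases "max 0 s \<le> b") (auto simp: max_def split: if_splits)
    finally show ?thesis .
  qed
  have "M = N"
    by (rule measure_eqI_lessThan) (simp_all add: M N, simp_all add: M_def N_def)
  have "(\<integral>\<^sup>+ p. indicator (cball 0 b) p * h (norm p) \<partial>(lborel :: (real \<times> real) measure))
      = integral\<^sup>N M h"
    unfolding M_def D_def
    by (simp add: nn_integral_distr nn_integral_density borel_measurable_indicator)
  also have "\<dots> = (\<integral>\<^sup>+ r. ennreal (2 * pi * r) * indicator {0..b} r * h r \<partial>lborel)"
    by (simp add: \<open>M = N\<close> N_def nn_integral_density)
  finally show ?thesis .
qed

section \<open>Solids of revolution by cylindrical shells\<close>

lemma rotate_about_y_axis_eq: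
  assumes "\<And>x y. (x, y) \<in> R \<Longrightarrow> 0 \<le> x"
  shows "rotate_about_y_axis R = {(u, y, w). (norm (u, w), y) \<in> R}"
proof (intro equalityI subsetI)
  fix p assume "p \<in> rotate_about_y_axis R"
  then obtain x y \<theta> where p: "p = (x * cos \<theta>, y, x * sin \<theta>)" and R: "(x, y) \<in> R"
    by (auto simp: rotate_about_y_axis_def)
  have "(x * cos \<theta>)\<^sup>2 + (x * sin \<theta>)\<^sup>2 = x\<^sup>2"
    by (simp add: power_mult_distrib flip: distrib_left)
  then have "norm (x * cos \<theta>, x * sin \<theta>) = x"
    using assms[OF R] by (simp add: norm_Pair)
  with R show "p \<in> {(u, y, w). (norm (u, w), y) \<in> R}"
    by (simp add: p)
next
  fix p :: "real \<times> real \<times> real" assume "p \<in> {(u, y, w). (norm (u, w), y) \<in> R}"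
  then obtain u y w where p: "p = (u, y, w)" and R: "(norm (u, w), y) \<in> R"
    by auto
  define \<theta> where "\<theta> = Arg (Complex u w)"
  have "norm (u, w) = cmod (Complex u w)"
    by (simp add: norm_Pair cmod_def)
  then have "u = norm (u, w) * cos \<theta>" "w = norm (u, w) * sin \<theta>"
    using rcis_cmod_Arg[of "Complex u w"] by (auto simp: rcis_def \<theta>_def complex_eq_iff)
  with R show "p \<in> rotate_about_y_axis R"
    unfolding rotate_about_y_axis_def p by blast
qed

text \<open>Parametrised by angles in \<open>[0, 2\<pi>]\<close>, the solid is a continuous image of a compact set.\<close>

lemma compact_rotate_about_y_axis:
  assumes "compact R"
  shows "compact (rotate_about_y_axis R)"
proof -
  have "rotate_about_y_axis R = (\<lambda>((x, y), \<theta>). (x * cos \<theta>, y, x * sin \<theta>)) ` (R \<times> {0..2 * pi})"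
  proof (intro equalityI subsetI)
    fix p assume "p \<in> rotate_about_y_axis R"
    then obtain x y \<theta> where p: "p = (x * cos \<theta>, y, x * sin \<theta>)" "(x, y) \<in> R"
      by (auto simp: rotate_about_y_axis_def)
    obtain t where "0 \<le> t" "t < 2 * pi" "cos \<theta> = cos t" "sin \<theta> = sin t"
      using sincos_total_2pi[of "cos \<theta>" "sin \<theta>"] by auto
    with p show "p \<in> (\<lambda>((x, y), \<theta>). (x * cos \<theta>, y, x * sin \<theta>)) ` (R \<times> {0..2 * pi})"
      by force
  qed (auto simp: rotate_about_y_axis_def)
  also have "compact \<dots>"
    using assms by (intro compact_continuous_image compact_Times)
      (auto simp: case_prod_unfold intro!: continuous_intros)
  finally show ?thesis .
qed

lemma sections_of_solid:
  "(\<lambda>y. (u, y, w)) -` rotate_about_y_axis (band b lo hi)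
    = (if norm (u, w) \<le> b then {lo (norm (u, w))..hi (norm (u, w))} else {})"
  by (subst rotate_about_y_axis_eq) (auto simp: band_def)

text \<open>
  The solid is cut along lines parallel to the axis. The one at distance \<open>r\<close> from the axis meets it
  in a segment of length \<open>hi r - lo r\<close>, which depends on the foot point only through \<open>r\<close>.
\<close>

lemma volume_by_shells:
  assumes cont: "continuous_on UNIV lo" "continuous_on UNIV hi"
    and b: "0 \<le> b" and le: "\<And>x. 0 \<le> x \<Longrightarrow> x \<le> b \<Longrightarrow> lo x \<le> hi x"
  shows "rotate_about_y_axis (band b lo hi) \<in> lmeasurable"
    and "measure lebesgue (rotate_about_y_axis (band b lo hi))
      = 2 * pi * integral {0..b} (\<lambda>x. x * (hi x - lo x))"
proof -
  let ?K = "rotate_about_y_axis (band b lo hi)"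
  have K: "compact ?K"
    using closed_band[OF cont] bounded_band[OF cont]
    by (intro compact_rotate_about_y_axis) (simp add: compact_eq_bounded_closed)
  then show "?K \<in> lmeasurable"
    by (rule lmeasurable_compact)
  have [measurable]: "?K \<in> sets borel"
    using K by (intro borel_closed compact_imp_closed)
  have [measurable]: "lo \<in> borel_measurable borel" "hi \<in> borel_measurable borel"
    using cont by (auto intro: borel_measurable_continuous_onI)
  let ?h = "\<lambda>r. ennreal (hi r - lo r)"
  have "emeasure lborel ?K = emeasure (lborel \<Otimes>\<^sub>M (lborel \<Otimes>\<^sub>M lborel)) ?K"
    by (simp add: lborel_prod)
  also have "\<dots> = (\<integral>\<^sup>+ u. emeasure (lborel \<Otimes>\<^sub>M lborel) (Pair u -` ?K) \<partial>lborel)"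
  proof (rule sigma_finite_measure.emeasure_pair_measure_alt)
    show "sigma_finite_measure (lborel \<Otimes>\<^sub>M lborel :: (real \<times> real) measure)"
      by (simp add: lborel_prod lborel.sigma_finite_measure_axioms)
    show "?K \<in> sets (lborel \<Otimes>\<^sub>M (lborel \<Otimes>\<^sub>M lborel))"
      unfolding lborel_prod by simp
  qed
  also have "\<dots> = (\<integral>\<^sup>+ u. \<integral>\<^sup>+ w. emeasure lborel ((\<lambda>y. (u, y, w)) -` ?K) \<partial>lborel \<partial>lborel)"
  proof (rule nn_integral_cong)
    fix u :: real
    have "closed (Pair u -` ?K)"
      using K by (intro closed_vimage compact_imp_closed continuous_intros)
    then have "Pair u -` ?K \<in> sets (lborel \<Otimes>\<^sub>M lborel)"
      unfolding lborel_prod by simp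
    then show "emeasure (lborel \<Otimes>\<^sub>M lborel) (Pair u -` ?K)
        = (\<integral>\<^sup>+ w. emeasure lborel ((\<lambda>y. (u, y, w)) -` ?K) \<partial>lborel)"
      by (simp add: lborel_pair.emeasure_pair_measure_alt2 vimage_def)
  qed
  also have "\<dots> = (\<integral>\<^sup>+ u. \<integral>\<^sup>+ w. indicator (cball (0 :: real \<times> real) b) (u, w) * ?h (norm (u, w)) \<partial>lborel \<partial>lborel)"
    by (intro nn_integral_cong) (auto simp: sections_of_solid le)
  also have "\<dots> = (\<integral>\<^sup>+ p. indicator (cball (0 :: real \<times> real) b) p * ?h (norm p) \<partial>lborel)"
  proof (subst sigma_finite_measure.nn_integral_fst)
    have "(\<lambda>p. ?h (norm p)) \<in> borel_measurable (lborel :: (real \<times> real) measure)"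
      by measurable
    then show "(\<lambda>p. indicator (cball (0 :: real \<times> real) b) p * ?h (norm p))
        \<in> borel_measurable (lborel \<Otimes>\<^sub>M lborel)"
      unfolding lborel_prod
      by (intro borel_measurable_times_ennreal borel_measurable_indicator) simp_all
  qed (simp_all add: lborel_prod lborel.sigma_finite_measure_axioms)
  also have "\<dots> = (\<integral>\<^sup>+ r. ennreal (2 * pi * r) * indicator {0..b} r * ?h r \<partial>lborel)"
    by (rule nn_integral_radial_disc) (use b in auto)
  also have "\<dots> = (\<integral>\<^sup>+ r. ennreal (indicator {0..b} r * (2 * pi * (r * (hi r - lo r)))) \<partial>lborel)"
    by (intro nn_integral_cong) (auto simp: indicator_def le ennreal_mult' mult.assoc)
  also have "\<dots> = ennreal (2 * pi * integral {0..b} (\<lambda>x. x * (hi x - lo x)))"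
  proof (rule nn_integral_has_integral_lebesgue)
    show "((\<lambda>r. 2 * pi * (r * (hi r - lo r))) has_integral
        2 * pi * integral {0..b} (\<lambda>x. x * (hi x - lo x))) {0..b}"
      using cont
      by (intro has_integral_mult_right integrable_integral integrable_continuous_real continuous_intros)
         (auto intro: continuous_on_subset)
  qed (simp add: le)
  finally have "emeasure lborel ?K = ennreal (2 * pi * integral {0..b} (\<lambda>x. x * (hi x - lo x)))" .
  moreover have "0 \<le> integral {0..b} (\<lambda>x. x * (hi x - lo x))"
    by (intro integral_nonneg integrable_continuous_real continuous_intros)
       (use cont le in \<open>auto intro: continuous_on_subset\<close>)
  ultimately show "measure lebesgue ?K = 2 * pi * integral {0..b} (\<lambda>x. x * (hi x - lo x))"
    by (simp add: measure_def)
qed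

section \<open>The region bounded by the curve\<close>

text \<open>
  Clamping the argument to \<open>[a, b]\<close> extends \<open>f\<close> by constants. On \<open>[0, a]\<close> this draws the horizontal
  segment from \<open>(0, f a)\<close> to \<open>(a, f a)\<close>, so that this segment and \<open>\<Gamma>\<close> become a single graph.
\<close>

lemma boundary_curve_eq:
  fixes f :: "real \<Rightarrow> real"
  assumes "0 \<le> a" "a \<le> b"
  defines "g \<equiv> \<lambda>x. f (min b (max a x))"
  shows "boundary_curve a b f =
    {0} \<times> {min (f a) (f b)..max (f a) (f b)} \<union> graph_curve 0 b g \<union> graph_curve 0 b (\<lambda>_. f b)"
proof -
  have "graph_curve 0 b g = graph_curve 0 a g \<union> graph_curve a b g"
    using assms(1,2) by (simp add: graph_curve_def ivl_disj_un_two_touch(4) flip: image_Un)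
  moreover have "graph_curve a b g = graph_curve a b f"
    by (auto simp: graph_curve_def g_def intro!: image_cong)
  moreover have "graph_curve 0 a g = closed_segment (0, f a) (a, f a)"
    using assms(1,2) by (auto simp: closed_segment_same_snd closed_segment_eq_real_ivl graph_curve_def g_def)
  moreover have "graph_curve 0 b (\<lambda>_. f b) = closed_segment (0, f b) (b, f b)"
    using assms(1,2) by (auto simp: closed_segment_same_snd closed_segment_eq_real_ivl graph_curve_def)
  ultimately show ?thesis
    by (auto simp: boundary_curve_def closed_segment_same_fst closed_segment_eq_real_ivl)
qed

lemma integral_clamped:
  fixes f :: "real \<Rightarrow> real"
  assumes "0 \<le> a" "a \<le> b" "continuous_on {a..b} f"
  defines "g \<equiv> \<lambda>x. f (min b (max a x))"
  shows "integral {0..b} (\<lambda>x. x * (f b - g x))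
    = (b\<^sup>2 * f b - a\<^sup>2 * f a) / 2 - integral {a..b} (\<lambda>x. x * f x)"
proof -
  have square: "((\<lambda>x. x) has_integral (t\<^sup>2 - s\<^sup>2) / 2) {s..t}" if "s \<le> t" for s t :: real
    using ident_has_integral[OF that] by (simp add: diff_divide_distrib)
  have "((\<lambda>x. x * (f b - f a)) has_integral a\<^sup>2 / 2 * (f b - f a)) {0..a}"
    using has_integral_mult_left[OF square[OF assms(1)], of "f b - f a"] by simp
  then have left: "((\<lambda>x. x * (f b - g x)) has_integral a\<^sup>2 / 2 * (f b - f a)) {0..a}"
    by (rule has_integral_eq[rotated]) (use assms(2) in \<open>auto simp: g_def\<close>)
  have "((\<lambda>x. x * f x) has_integral integral {a..b} (\<lambda>x. x * f x)) {a..b}"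
    by (intro integrable_integral integrable_continuous_real continuous_intros assms)
  then have "((\<lambda>x. x * f b - x * f x) has_integral
      ((b\<^sup>2 - a\<^sup>2) / 2) * f b - integral {a..b} (\<lambda>x. x * f x)) {a..b}"
    by (intro has_integral_diff has_integral_mult_left square assms)
  then have right: "((\<lambda>x. x * (f b - g x)) has_integral
      ((b\<^sup>2 - a\<^sup>2) / 2) * f b - integral {a..b} (\<lambda>x. x * f x)) {a..b}"
    by (rule has_integral_eq[rotated]) (auto simp: g_def right_diff_distrib)
  from has_integral_combine[OF assms(1,2) left right] show ?thesis
    by (simp add: integral_unique field_simps)
qed

text \<open>If \<open>f\<close> reached the level \<open>f b\<close> or rose above it before \<open>b\<close>, it would already have taken the
  value \<open>f b\<close> there by the intermediate value theorem.\<close>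

lemma less_if_attained_once:
  fixes f :: "real \<Rightarrow> real"
  assumes "continuous_on {a..b} f" "f a < f b"
    and "\<And>x. x \<in> {a..b} \<Longrightarrow> f x = f b \<Longrightarrow> x = b"
    and "x \<in> {a..<b}"
  shows "f x < f b"
proof (rule ccontr)
  assume "\<not> f x < f b"
  then obtain z where "a \<le> z" "z \<le> x" "f z = f b"
    using IVT'[of f a "f b" x] assms continuous_on_subset[OF assms(1), of "{a..x}"] by force
  then show False
    using assms(3)[of z] assms(4) by auto
qed

theorem theorem2:
  fixes a b c d :: real and f :: "real \<Rightarrow> real"
  assumes "0 \<le> a" and "a < b"
    and "continuous_on {a..b} f"
    and "piecewise_strictly_monotone a b f"
    and "f differentiable_on {a..b}"
    and "c = min (f a) (f b)" and "d = max (f a) (f b)"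
    and "c < d"
    and "\<exists>!p. p \<in> graph_curve a b f \<and> snd p = c"
    and "\<exists>!p. p \<in> graph_curve a b f \<and> snd p = d"
  shows "rotate_about_y_axis (plane_region a b f) \<in> lmeasurable \<and>
         measure lebesgue (rotate_about_y_axis (plane_region a b f)) =
           sgn (f b - f a) *
             (pi * (b\<^sup>2 * f b - a\<^sup>2 * f a) - 2 * pi * integral {a..b} (\<lambda>x. x * f x))"
proof -
  define g where "g = (\<lambda>x. f (min b (max a x)))"
  have g_cont: "continuous_on UNIV g"
    unfolding g_def using assms(2)
    by (intro continuous_on_compose2[OF assms(3)] continuous_intros) auto
  have b: "0 < b" and gb: "g b = f b" and g0: "g 0 = f a"
    using assms(1,2) by (auto simp: g_def)
  have "\<exists>!p. p \<in> graph_curve a b f \<and> snd p = f b"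
    using assms(6,7,9,10) by (cases "f a \<le> f b") auto
  moreover have "(b, f b) \<in> graph_curve a b f"
    using assms(2) by (auto simp: graph_curve_def)
  ultimately have once: "x = b" if "x \<in> {a..b}" "f x = f b" for x
    using that by (metis graph_curve_def image_eqI prod.inject snd_conv)
  have clamp: "min b (max a x) \<in> {a..<b}" if "x < b" for x
    using that assms(2) by auto
  have boundary: "boundary_curve a b f = {0} \<times> {min (f a) (f b)..max (f a) (f b)}
      \<union> graph_curve 0 b g \<union> graph_curve 0 b (\<lambda>_. f b)"
    unfolding g_def using assms(1,2) by (intro boundary_curve_eq) auto
  have integral: "2 * pi * integral {0..b} (\<lambda>x. x * (f b - g x))
      = pi * (b\<^sup>2 * f b - a\<^sup>2 * f a) - 2 * pi * integral {a..b} (\<lambda>x. x * f x)"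
    unfolding g_def using assms(1,2,3) by (subst integral_clamped) (auto simp: field_simps)
  consider "f a < f b" | "f b < f a"
    using assms(6,7,8) by fastforce
  then show ?thesis
  proof cases
    case 1
    have less: "g x < f b" if "0 \<le> x" "x < b" for x
      unfolding g_def by (rule less_if_attained_once[OF assms(3) 1 once clamp]) (use that in auto)
    then have le: "g x \<le> f b" if "0 \<le> x" "x \<le> b" for x
      using that gb by (cases "x = b") (auto intro: less_imp_le)
    have "boundary_curve a b f = band_boundary b g (\<lambda>_. f b)"
      using 1 by (simp add: boundary band_boundary_def g0)
    then have "plane_region a b f = band b g (\<lambda>_. f b)"
      unfolding plane_region_def using g_cont b gb less by (simp add: inside_band_boundary)
    then show ?thesis
      using volume_by_shells[of g "\<lambda>_. f b" b] g_cont b le 1 by (simp add: integral)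
  next
    case 2
    \<comment> \<open>The mirror image \<open>- f\<close> has its larger endpoint value at \<open>b\<close>.\<close>
    have less: "f b < g x" if "0 \<le> x" "x < b" for x
      using less_if_attained_once[of a b "\<lambda>x. - f x" "min b (max a x)"]
        continuous_on_minus[OF assms(3)] 2 once clamp[OF that(2)]
      by (simp add: g_def)
    then have le: "f b \<le> g x" if "0 \<le> x" "x \<le> b" for x
      using that gb by (cases "x = b") (auto intro: less_imp_le)
    have "boundary_curve a b f = band_boundary b (\<lambda>_. f b) g"
      using 2 by (auto simp: boundary band_boundary_def g0)
    then have "plane_region a b f = band b (\<lambda>_. f b) g"
      unfolding plane_region_def using g_cont b gb less by (simp add: inside_band_boundary)
    moreover have "integral {0..b} (\<lambda>x. x * (g x - f b)) = - integral {0..b} (\<lambda>x. x * (f b - g x))"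
      by (simp add: algebra_simps flip: integral_neg)
    ultimately show ?thesis
      using volume_by_shells[of "\<lambda>_. f b" g b] g_cont b le 2 integral by simp
  qed
qed

end
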